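(* Let $I\subseteq\mathbb{R}$ be a nonempty open interval and assume that $\varphi,f,F:I\to\mathbb{R}$ satisfy $$\varphi\Big(\frac{x+y}{2}\Big)\big(f(x)-f(y)\big)=F(x)-F(y)\qquad\text{for all }x,y\in I.$$ Then, for all $h>0$, $$\varphi\Big(\frac{x+y}2\Big)\big(\delta_hf(x)+\delta_hf(y)\big)=\varphi(x)\,\delta_hf(x)+\varphi(y)\,\delta_hf(y)\qquad\text{for all }x,y\in I_h.$$ Furthermore, if $\varphi$ is continuous and locally non-constant on $I$, then $f$ is infinitely many times differentiable on $I$ and $$\varphi\Big(\frac{x+y}2\Big)\big(f'(x)+f'(y)\big)=\varphi(x)f'(x)+\varphi(y)f'(y)\qquad\text{for all }x,y\in I.$$
   Context: For $h>0$ and $f:I\to\mathbb{R}$: $I_h:=(I-h)\cap(I+h)$ (possibly empty), and $\delta_hf:I_h\to\mathbb{R}$ is $\delta_hf(x):=f(x+h)-f(x-h)$. A subinterval $J\subseteq I$ is called proper if it has at least two elements and is different from $I$. A function $g:I\to\mathbb{R}$ is locally non-constant on $I$ if there is no proper subinterval of $I$ on which $g$ is constant (equivalently, every level set $g^{-1}(\{\lambda\})$, $\lambda\in\mathbb{R}$, has empty interior). *)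

theory Defs
  imports "HOL-Analysis.Analysis"
begin

text \<open>
  Functions on an interval \<open>I\<close> are rendered as total functions on the reals; everything below
  only refers to their values on \<open>I\<close>.
\<close>

definition shrink :: "real \<Rightarrow> real set \<Rightarrow> real set" where
  "shrink h I = (\<lambda>x. x - h) ` I \<inter> (\<lambda>x. x + h) ` I"

definition sym_diff_op :: "real \<Rightarrow> (real \<Rightarrow> real) \<Rightarrow> real \<Rightarrow> real" where
  "sym_diff_op h f x = f (x + h) - f (x - h)"

definition proper_subinterval :: "real set \<Rightarrow> real set \<Rightarrow> bool" where
  "proper_subinterval J I \<longleftrightarrow>
     is_interval J \<and> J \<subseteq> I \<and> (\<exists>a\<in>J. \<exists>b\<in>J. a \<noteq> b) \<and> J \<noteq> I"

definition locally_nonconstant_on :: "(real \<Rightarrow> real) \<Rightarrow> real set \<Rightarrow> bool" where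
  "locally_nonconstant_on g I \<longleftrightarrow> \<not> (\<exists>J. proper_subinterval J I \<and> g constant_on J)"

text \<open>
  Intended for open \<open>I\<close>: there every iterate \<open>(deriv ^^ n) f\<close> is, on \<open>I\<close>, determined by
  \<open>f\<close> on \<open>I\<close>. Since \<^const>\<open>deriv\<close> is total, the definition demands genuine
  differentiability of the function itself and of each derivative, at every point of \<open>I\<close>.
\<close>

definition infinitely_differentiable_on :: "(real \<Rightarrow> real) \<Rightarrow> real set \<Rightarrow> bool" where
  "infinitely_differentiable_on f I \<longleftrightarrow>
     (\<forall>n. \<forall>x\<in>I. (deriv ^^ n) f field_differentiable at x)"

end

theory Submission
  imports Defs
begin

text \<open>
  Part one is obtained by adding the equation at the pairs \<open>(x + h, y - h)\<close> and
  \<open>(y + h, x - h)\<close>, which have the same midpoint as \<open>(x, y)\<close>.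

  For the regularity of \<open>f\<close>, summing the equation cyclically over \<open>x, y, z\<close> and solving for
  \<open>f x\<close> shows that \<open>f\<close> and \<open>F\<close> are as regular near \<open>x\<close> as \<open>\<phi>\<close> is near two midpoints at which
  \<open>\<phi>\<close> takes different values. Conversely, if \<open>G' = f\<close> and \<open>H' = F\<close>, integrating
  \<open>\<phi> u (f (u + v) - f (u - v)) = F (u + v) - F (u - v)\<close> in \<open>v\<close> expresses \<open>\<phi>\<close> through \<open>G\<close> and
  \<open>H\<close>, so \<open>\<phi>\<close> is once more differentiable than \<open>f\<close> and \<open>F\<close> at every point about which \<open>f\<close> is
  not symmetric. Unless \<open>f\<close> is constant, such points are dense, and a bootstrap gives
  smoothness of \<open>f\<close>. The last identity is the limit of part one divided by \<open>2 h\<close>.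
\<close>

section \<open>Calculus of \<open>C^k\<close> functions on open sets\<close>

text \<open>
  Meaningful for open \<open>A\<close> only, since \<^const>\<open>deriv\<close> looks at values of \<open>g\<close> around each point of \<open>A\<close>.
\<close>

primrec Ck_on :: "nat \<Rightarrow> (real \<Rightarrow> real) \<Rightarrow> real set \<Rightarrow> bool" where
  "Ck_on 0 g A \<longleftrightarrow> continuous_on A g"
| "Ck_on (Suc k) g A \<longleftrightarrow> (\<forall>x\<in>A. g field_differentiable at x) \<and> Ck_on k (deriv g) A"

text \<open>Openness turns agreement on \<open>A\<close> into agreement near each point, which is
  what \<open>deriv\<close> depends on.\<close>

lemma Ck_on_cong:
  assumes "open A" "\<And>x. x \<in> A \<Longrightarrow> g x = h x"
  shows "Ck_on k g A \<longleftrightarrow> Ck_on k h A"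
  using assms(2)
proof (induction k arbitrary: g h)
  case 0
  then show ?case by (simp cong: continuous_on_cong)
next
  case (Suc k)
  have ev: "eventually (\<lambda>y. g y = h y) (nhds x)" if "x \<in> A" for x
    using that assms(1) Suc.prems by (auto simp: eventually_nhds)
  have "deriv g x = deriv h x" if "x \<in> A" for x
    using ev[OF that] by (intro deriv_cong_ev) auto
  then have "Ck_on k (deriv g) A \<longleftrightarrow> Ck_on k (deriv h) A"
    by (rule Suc.IH)
  moreover have "g field_differentiable at x \<longleftrightarrow> h field_differentiable at x" if "x \<in> A" for x
    using DERIV_cong_ev[OF refl ev[OF that] refl] by (simp add: field_differentiable_def)
  ultimately show ?case by simp
qed

lemma Ck_on_transform:
  assumes "open A" "Ck_on k g A" "\<And>x. x \<in> A \<Longrightarrow> h x = g x"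
  shows "Ck_on k h A"
  using Ck_on_cong[of A h g k] assms by simp

text \<open>Lets an explicit derivative \<open>g'\<close> stand in for \<open>deriv g\<close>, so
  that the inductive closure rules below follow from the usual differentiation rules.\<close>

lemma Ck_on_SucI:
  assumes "open A" "\<And>x. x \<in> A \<Longrightarrow> (g has_real_derivative g' x) (at x)" "Ck_on k g' A"
  shows "Ck_on (Suc k) g A"
proof -
  have "Ck_on k (deriv g) A \<longleftrightarrow> Ck_on k g' A"
    using assms by (intro Ck_on_cong) (auto intro: DERIV_imp_deriv)
  then show ?thesis
    using assms by (auto simp: field_differentiable_def)
qed

lemma Ck_on_has_deriv:
  "Ck_on (Suc k) g A \<Longrightarrow> x \<in> A \<Longrightarrow> (g has_real_derivative deriv g x) (at x)"
  by (simp add: DERIV_deriv_iff_field_differentiable)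

lemma Ck_on_subset: "Ck_on k g A \<Longrightarrow> B \<subseteq> A \<Longrightarrow> Ck_on k g B"
  by (induction k arbitrary: g) (auto intro: continuous_on_subset)

lemma Ck_on_Suc_imp: "Ck_on (Suc k) g A \<Longrightarrow> Ck_on k g A"
proof (induction k arbitrary: g)
  case 0
  then show ?case
    by (auto intro!: continuous_at_imp_continuous_on field_differentiable_imp_continuous_at)
next
  case (Suc k)
  then show ?case by (metis Ck_on.simps(2))
qed

lemma Ck_on_imp_continuous_on: "Ck_on k g A \<Longrightarrow> continuous_on A g"
  by (induction k) (auto dest: Ck_on_Suc_imp simp del: Ck_on.simps(2))

text \<open>The neighbourhood may depend on the point, so formulas for \<open>f\<close>,
  \<open>F\<close> and \<phi> are needed only near each point.\<close>

lemma Ck_on_local: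
  assumes "\<And>x. x \<in> A \<Longrightarrow> \<exists>B. open B \<and> x \<in> B \<and> Ck_on k g B"
  shows "Ck_on k g A"
  using assms
proof (induction k arbitrary: g)
  case 0
  have "isCont g x" if "x \<in> A" for x
    using 0[OF that] by (auto simp: continuous_on_eq_continuous_at)
  then show ?case by (auto intro: continuous_at_imp_continuous_on)
next
  case (Suc k)
  have "Ck_on k (deriv g) A"
    using Suc.prems by (intro Suc.IH) fastforce
  moreover have "g field_differentiable at x" if "x \<in> A" for x
    using Suc.prems[OF that] by auto
  ultimately show ?case by simp
qed

lemma Ck_on_const: "open A \<Longrightarrow> Ck_on k (\<lambda>x. c) A"
  by (induction k arbitrary: c)
     (auto intro: Ck_on_SucI[where g' = "\<lambda>x. 0"] simp del: Ck_on.simps(2))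

lemma Ck_on_add:
  assumes "open A"
  shows "Ck_on k g A \<Longrightarrow> Ck_on k h A \<Longrightarrow> Ck_on k (\<lambda>x. g x + h x) A"
proof (induction k arbitrary: g h)
  case (Suc k)
  have "Ck_on k (\<lambda>x. deriv g x + deriv h x) A"
    using Suc.prems by (intro Suc.IH) auto
  then show ?case
    by (rule Ck_on_SucI[OF assms, rotated])
       (intro DERIV_add Ck_on_has_deriv[OF Suc.prems(1)] Ck_on_has_deriv[OF Suc.prems(2)])
qed (auto intro: continuous_intros)

lemma Ck_on_mult:
  assumes "open A"
  shows "Ck_on k g A \<Longrightarrow> Ck_on k h A \<Longrightarrow> Ck_on k (\<lambda>x. g x * h x) A"
proof (induction k arbitrary: g h)
  case (Suc k)
  have "Ck_on k (\<lambda>x. deriv g x * h x + deriv h x * g x) A"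
    using Suc.prems Suc.prems[THEN Ck_on_Suc_imp]
    by (intro Ck_on_add assms Suc.IH) auto
  then show ?case
    by (rule Ck_on_SucI[OF assms, rotated])
       (intro DERIV_mult Ck_on_has_deriv[OF Suc.prems(1)] Ck_on_has_deriv[OF Suc.prems(2)])
qed (auto intro: continuous_intros)

lemma Ck_on_diff:
  assumes "open A" "Ck_on k g A" "Ck_on k h A"
  shows "Ck_on k (\<lambda>x. g x - h x) A"
  using Ck_on_add[OF assms(1,2) Ck_on_mult[OF assms(1) Ck_on_const[OF assms(1), where c = "-1"] assms(3)]]
  by simp

lemma Ck_on_inverse:
  assumes "open A" "\<And>x. x \<in> A \<Longrightarrow> g x \<noteq> 0"
  shows "Ck_on k g A \<Longrightarrow> Ck_on k (\<lambda>x. inverse (g x)) A"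
proof (induction k)
  case 0
  then show ?case using assms by (auto intro: continuous_intros)
next
  case (Suc k)
  have "Ck_on k (\<lambda>x. (-1) * (inverse (g x) * deriv g x * inverse (g x))) A"
    using Suc.prems Suc.IH[OF Suc.prems[THEN Ck_on_Suc_imp]]
    by (intro Ck_on_mult Ck_on_const assms(1)) auto
  moreover have "((\<lambda>x. inverse (g x)) has_real_derivative
      (-1) * (inverse (g x) * deriv g x * inverse (g x))) (at x)" if "x \<in> A" for x
    using DERIV_inverse'[OF Ck_on_has_deriv[OF Suc.prems that] assms(2)[OF that]] by simp
  ultimately show ?case
    using assms(1) by (intro Ck_on_SucI)
qed

lemma Ck_on_divide:
  assumes "open A" "Ck_on k g A" "Ck_on k h A" "\<And>x. x \<in> A \<Longrightarrow> h x \<noteq> 0"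
  shows "Ck_on k (\<lambda>x. g x / h x) A"
  unfolding divide_inverse using assms by (intro Ck_on_mult Ck_on_inverse) auto

lemma Ck_on_affine:
  assumes "open B" "\<And>x. x \<in> B \<Longrightarrow> c * x + d \<in> A"
  shows "Ck_on k g A \<Longrightarrow> Ck_on k (\<lambda>x. g (c * x + d)) B"
proof (induction k arbitrary: g)
  case 0
  then show ?case using assms(2)
    by (auto intro!: continuous_on_compose2[of A g] continuous_intros)
next
  case (Suc k)
  have "Ck_on k (\<lambda>x. deriv g (c * x + d) * c) B"
    using Suc.prems by (intro Ck_on_mult Ck_on_const Suc.IH assms(1)) auto
  moreover have "((\<lambda>x. g (c * x + d)) has_real_derivative deriv g (c * x + d) * c) (at x)"
    if "x \<in> B" for x
    by (rule DERIV_chain2[where f = g and g = "\<lambda>x. c * x + d", OF Ck_on_has_deriv[OF Suc.prems assms(2)[OF that]]])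
       (auto intro!: derivative_eq_intros)
  ultimately show ?case
    using assms(1) by (intro Ck_on_SucI)
qed

lemma Ck_on_translate:
  assumes "open B" "\<And>x. x \<in> B \<Longrightarrow> x + d \<in> A" "Ck_on k g A"
  shows "Ck_on k (\<lambda>x. g (x + d)) B"
  using Ck_on_affine[of B 1 d A] assms by simp

lemma Ck_on_midpoint:
  assumes "open B" "\<And>x. x \<in> B \<Longrightarrow> (x + y) / 2 \<in> A" "Ck_on k g A"
  shows "Ck_on k (\<lambda>x. g ((x + y) / 2)) B"
  using Ck_on_affine[of B "1 / 2" "y / 2" A] assms by (simp add: add_divide_distrib)

lemma Ck_on_imp_deriv_funpow:
  "Ck_on (Suc n) g A \<Longrightarrow> x \<in> A \<Longrightarrow> (deriv ^^ n) g field_differentiable at x"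
  \<comment> \<open>Peeling off the innermost \<open>deriv\<close> matches the recursion of
    \<open>Ck_on\<close>, which passes from \<open>g\<close> to \<open>deriv g\<close>.\<close>
  by (induction n arbitrary: g) (auto simp: funpow_Suc_right simp del: funpow.simps)

section \<open>Antiderivatives on open intervals\<close>

text \<open>Since \<open>I\<close> may be unbounded, its endpoints are taken in
  \<open>ereal\<close>; a real number lies in \<open>I\<close> exactly when it is strictly between
  them, so \<open>einterval_antiderivative\<close> applies.\<close>

lemma open_interval_antiderivative:
  fixes f :: "real \<Rightarrow> real"
  assumes "open I" "is_interval I" "continuous_on I f"
  obtains G where "\<And>x. x \<in> I \<Longrightarrow> (G has_real_derivative f x) (at x)"
proof (cases "I = {}")
  case False
  define a b where "a = (INF x\<in>I. ereal x)" and "b = (SUP x\<in>I. ereal x)"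
  have 1: "x \<in> I" if "a < ereal x" "ereal x < b" for x
  proof -
    from that obtain p q where "p \<in> I" "q \<in> I" "p < x" "x < q"
      unfolding a_def b_def by (auto simp: INF_less_iff less_SUP_iff)
    then show ?thesis
      using assms(2) by (meson is_interval_1 less_imp_le)
  qed
  have 2: "a < ereal x" "ereal x < b" if x: "x \<in> I" for x
  proof -
    obtain e where e: "e > 0" "ball x e \<subseteq> I"
      using x assms(1) open_contains_ball by blast
    then have "x - e/2 \<in> I" "x + e/2 \<in> I"
      by (auto simp: subset_iff dist_real_def)
    then show "a < ereal x" "ereal x < b"
      using e(1) unfolding a_def b_def INF_less_iff less_SUP_iff by force+
  qed
  have "a < b"
    using False 2 by (meson ex_in_conv less_trans)
  moreover have "isCont f x" if "a < ereal x" "ereal x < b" for x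
    using 1[OF that] assms by (simp add: continuous_on_eq_continuous_at)
  ultimately obtain G where "\<forall>x::real. a < x \<longrightarrow> x < b \<longrightarrow> (G has_vector_derivative f x) (at x)"
    using einterval_antiderivative by blast
  then show ?thesis
    using 2 that[of G] by (simp add: has_real_derivative_iff_has_vector_derivative)
qed (use that in auto)

section \<open>The symmetric difference identity\<close>

lemma sym_diff_identity:
  assumes eq: "\<forall>x\<in>I. \<forall>y\<in>I. \<phi> ((x + y) / 2) * (f x - f y) = F x - F y"
    and "x \<in> shrink h I" "y \<in> shrink h I"
  shows "\<phi> ((x + y) / 2) * (sym_diff_op h f x + sym_diff_op h f y)
           = \<phi> x * sym_diff_op h f x + \<phi> y * sym_diff_op h f y"
proof -
  have I: "x + h \<in> I" "x - h \<in> I" "y + h \<in> I" "y - h \<in> I"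
    using assms(2,3) by (auto simp: shrink_def)
  \<comment> \<open>The first two right-hand sides and the last two have the same sum,
    \<open>sym_diff_op h F x + sym_diff_op h F y\<close>.\<close>
  have "\<phi> ((x + y) / 2) * (f (x + h) - f (y - h)) = F (x + h) - F (y - h)"
    "\<phi> ((x + y) / 2) * (f (y + h) - f (x - h)) = F (y + h) - F (x - h)"
    "\<phi> x * (f (x + h) - f (x - h)) = F (x + h) - F (x - h)"
    "\<phi> y * (f (y + h) - f (y - h)) = F (y + h) - F (y - h)"
    using eq[rule_format, OF I(1,4)] eq[rule_format, OF I(3,2)]
      eq[rule_format, OF I(1,2)] eq[rule_format, OF I(3,4)]
    by (simp_all add: add.commute)
  then show ?thesis
    unfolding sym_diff_op_def by (simp add: algebra_simps)
qed

section \<open>The three-point formula and the spread of constancy\<close>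

locale midpoint_equation =
  fixes I :: "real set" and \<phi> f F :: "real \<Rightarrow> real"
  assumes I_open: "open I" and I_interval: "is_interval I"
    and eq: "\<And>x y. x \<in> I \<Longrightarrow> y \<in> I \<Longrightarrow> \<phi> ((x + y) / 2) * (f x - f y) = F x - F y"
    and cont: "continuous_on I \<phi>" and nonconst: "locally_nonconstant_on \<phi> I"
begin

lemma mem_between: "a \<in> I \<Longrightarrow> b \<in> I \<Longrightarrow> a \<le> x \<Longrightarrow> x \<le> b \<Longrightarrow> x \<in> I"
  using I_interval by (meson is_interval_1)

lemma midpoint_mem:
  assumes "x \<in> I" "y \<in> I"
  shows "(x + y) / 2 \<in> I"
proof (cases "x \<le> y")
  case True
  then show ?thesis using assms by (simp add: mem_between[of x y])
next
  case False
  then show ?thesis using assms by (simp add: mem_between[of y x])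
qed

lemma phi_nonconst:
  assumes "a < b" "{a<..<b} \<subseteq> I"
  obtains p q where "p \<in> {a<..<b}" "q \<in> {a<..<b}" "\<phi> p \<noteq> \<phi> q"
proof -
  \<comment> \<open>The interval \<open>{a<..<b}\<close> may be all of \<open>I\<close> and hence
    not proper. Its closed middle third is proper, as it misses the point \<open>(a + c) / 2\<close>
    of \<open>I\<close>.\<close>
  define c d where "c = a + (b - a) / 3" and "d = b - (b - a) / 3"
  have cd: "a < c" "c < d" "d < b"
    using assms(1) by (auto simp: c_def d_def field_simps)
  have "(a + c) / 2 \<in> I" "(a + c) / 2 \<notin> {c..d}"
    using assms(2) cd by (auto simp: subset_iff)
  then have "{c..d} \<noteq> I" by blast
  moreover have "{c..d} \<subseteq> I"
    using assms(2) cd by (auto simp: subset_iff)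
  moreover have "\<exists>x\<in>{c..d}. \<exists>y\<in>{c..d}. x \<noteq> y"
    using cd by (intro bexI[of _ c] bexI[of _ d]) auto
  ultimately have "proper_subinterval {c..d} I"
    by (auto simp: proper_subinterval_def is_interval_cc)
  then have "\<not> \<phi> constant_on {c..d}"
    using nonconst by (auto simp: locally_nonconstant_on_def)
  then obtain p where "p \<in> {c..d}" "\<phi> p \<noteq> \<phi> c"
    unfolding constant_on_def by blast
  then show ?thesis
    using that[of p c] cd by auto
qed

text \<open>In the cyclic sum of the equation over the three pairs, \<open>F\<close> cancels. Where
  the coefficient of \<open>f x\<close> is nonzero, \<open>f x\<close> is determined by \<phi> and
  the two values \<open>f y\<close> and \<open>f z\<close>.\<close>

lemma f_three_points:
  assumes "x \<in> I" "y \<in> I" "z \<in> I"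
  shows "f x * (\<phi> ((x + y) / 2) - \<phi> ((x + z) / 2))
    = f y * (\<phi> ((x + y) / 2) - \<phi> ((y + z) / 2)) + f z * (\<phi> ((y + z) / 2) - \<phi> ((x + z) / 2))"
  using eq[OF assms(1,2)] eq[OF assms(2,3)] eq[OF assms(1,3)] by (simp add: algebra_simps)

text \<open>The midpoints of \<open>x\<close> with points of \<open>{a<..<b}\<close> fill an
  interval in \<open>I\<close>, on which \<phi> takes two different values. The three-point formula
  with \<open>f y = f z = c\<close> then forces \<open>f x = c\<close>.\<close>

lemma f_const_extend:
  assumes ab: "a < b" "{a<..<b} \<subseteq> I" and c: "\<And>x. x \<in> {a<..<b} \<Longrightarrow> f x = c" and x: "x \<in> I"
  shows "f x = c"
proof -
  have sub: "{(x + a) / 2<..<(x + b) / 2} \<subseteq> I"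
  proof
    fix t assume t: "t \<in> {(x + a) / 2<..<(x + b) / 2}"
    then have "2 * t - x \<in> I"
      using ab(2) by (auto simp: subset_iff)
    from midpoint_mem[OF x this] show "t \<in> I" by simp
  qed
  from ab(1) have "(x + a) / 2 < (x + b) / 2" by simp
  from phi_nonconst[OF this sub] obtain p q where
    pq: "p \<in> {(x + a) / 2<..<(x + b) / 2}" "q \<in> {(x + a) / 2<..<(x + b) / 2}" "\<phi> p \<noteq> \<phi> q" .
  \<comment> \<open>The reflections of \<open>x\<close> about \<open>p\<close> and \<open>q\<close>,
    so that these become the midpoints.\<close>
  define y z where "y = 2 * p - x" and "z = 2 * q - x"
  have yz: "y \<in> {a<..<b}" "z \<in> {a<..<b}" "\<phi> ((x + y) / 2) = \<phi> p" "\<phi> ((x + z) / 2) = \<phi> q"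
    using pq by (auto simp: y_def z_def field_simps)
  then have "y \<in> I" "z \<in> I" using ab by auto
  from f_three_points[OF x this] c[OF yz(1)] c[OF yz(2)]
  have "(f x - c) * (\<phi> p - \<phi> q) = 0"
    unfolding yz(3,4) by (simp add: algebra_simps)
  then show ?thesis using pq(3) by simp
qed

section \<open>Regularity passes from \<phi> to \<open>f\<close> and \<open>F\<close>\<close>

text \<open>The last condition on \<open>W\<close> is density in \<open>I\<close>. The three-point
  formula uses \<phi> only near two midpoints, and density allows these to be chosen in
  \<open>W\<close>; so regularity on a dense open set yields regularity on all of
  \<open>I\<close>.\<close>

lemma Ck_on_f_F:
  assumes W: "open W" "W \<subseteq> I" "\<And>a b. a < b \<Longrightarrow> {a<..<b} \<subseteq> I \<Longrightarrow> {a<..<b} \<inter> W \<noteq> {}"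
    and ck: "Ck_on k \<phi> W"
  shows "Ck_on k f I" "Ck_on k F I"
proof -
  have "\<exists>B. open B \<and> x0 \<in> B \<and> Ck_on k f B \<and> Ck_on k F B" if x0: "x0 \<in> I" for x0
  proof -
    obtain e where e: "e > 0" "ball x0 e \<subseteq> I"
      using x0 I_open open_contains_ball by blast
    \<comment> \<open>The radius is halved because reflecting \<open>x0\<close> about a point of
      \<open>J\<close> doubles the distance from \<open>x0\<close>.\<close>
    define J where "J = {x0 - e / 2<..<x0 + e / 2}"
    have "J \<subseteq> I" using e by (auto simp: J_def subset_iff dist_real_def)
    then have "J \<inter> W \<noteq> {}"
      unfolding J_def using e(1) by (intro W(3)) auto
    then obtain w where w: "w \<in> J \<inter> W" by blast
    have "open (J \<inter> W)" using W(1) by (auto simp: J_def)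
    then obtain r where r: "r > 0" "ball w r \<subseteq> J \<inter> W"
      using w open_contains_ball by blast
    have br: "{w - r<..<w + r} = ball w r" by (auto simp: dist_real_def)
    have "{w - r<..<w + r} \<subseteq> I" using r W(2) unfolding br by blast
    moreover have "w - r < w + r" using r by simp
    ultimately obtain p q where "p \<in> {w - r<..<w + r}" "q \<in> {w - r<..<w + r}"
      and pq: "\<phi> p \<noteq> \<phi> q"
      using phi_nonconst by metis
    then have "p \<in> J \<inter> W" "q \<in> J \<inter> W" unfolding br using r by blast+
    then have pqJ: "p \<in> J" "q \<in> J" and pqW: "p \<in> W" "q \<in> W" by auto
    define y z where "y = 2 * p - x0" and "z = 2 * q - x0"
    have "y \<in> ball x0 e" "z \<in> ball x0 e"
      using pqJ by (auto simp: y_def z_def J_def dist_real_def abs_less_iff)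
    then have yz: "y \<in> I" "z \<in> I" using e by auto
    have mid: "(x0 + y) / 2 = p" "(x0 + z) / 2 = q" by (auto simp: y_def z_def)
    \<comment> \<open>Now \<open>y\<close> and \<open>z\<close> stay fixed while \<open>x\<close>
      moves: \<open>B0\<close> keeps both midpoints in \<open>W\<close>, and \<open>B\<close> also
      keeps the denominator \<open>D x\<close> nonzero.\<close>
    define B0 where "B0 = I \<inter> (\<lambda>x. (x + y) / 2) -` W \<inter> (\<lambda>x. (x + z) / 2) -` W"
    define D where "D = (\<lambda>x. \<phi> ((x + y) / 2) - \<phi> ((x + z) / 2))"
    define B where "B = B0 \<inter> D -` (- {0})"
    have B0: "open B0"
      unfolding B0_def using W(1) I_open by (intro open_Int open_vimage continuous_intros) auto
    have my: "Ck_on k (\<lambda>x. \<phi> ((x + y) / 2)) B0" and mz: "Ck_on k (\<lambda>x. \<phi> ((x + z) / 2)) B0"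
      by (rule Ck_on_midpoint[OF B0 _ ck], simp add: B0_def)+
    have D: "Ck_on k D B0"
      unfolding D_def by (intro Ck_on_diff B0 my mz)
    have B: "open B"
      unfolding B_def
      by (intro continuous_open_preimage Ck_on_imp_continuous_on[OF D] B0) auto
    have "x0 \<in> B"
      using x0 pq pqW by (auto simp: B_def B0_def D_def mid)
    have sub: "B \<subseteq> B0" "B \<subseteq> I" by (auto simp: B_def B0_def)
    note my' = Ck_on_subset[OF my sub(1)] and mz' = Ck_on_subset[OF mz sub(1)]
      and D' = Ck_on_subset[OF D sub(1)]
    have "Ck_on k (\<lambda>x. (f y * (\<phi> ((x + y) / 2) - \<phi> ((y + z) / 2))
        + f z * (\<phi> ((y + z) / 2) - \<phi> ((x + z) / 2))) / D x) B"
      by (intro Ck_on_divide Ck_on_add Ck_on_diff Ck_on_mult Ck_on_const B my' mz' D')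
         (auto simp: B_def)
    moreover have "f x = (f y * (\<phi> ((x + y) / 2) - \<phi> ((y + z) / 2))
        + f z * (\<phi> ((y + z) / 2) - \<phi> ((x + z) / 2))) / D x" if "x \<in> B" for x
      using f_three_points[of x y z] that sub yz
      by (auto simp: B_def D_def field_simps)
    ultimately have fB: "Ck_on k f B"
      by (rule Ck_on_transform[OF B])
    \<comment> \<open>With \<open>y\<close> fixed, the equation itself recovers \<open>F\<close>
      from \<phi> and \<open>f\<close>.\<close>
    have "Ck_on k (\<lambda>x. F y + \<phi> ((x + y) / 2) * (f x - f y)) B"
      by (intro Ck_on_add Ck_on_diff Ck_on_mult Ck_on_const B my' fB)
    moreover have "F x = F y + \<phi> ((x + y) / 2) * (f x - f y)" if "x \<in> B" for x
      using eq[of x y] that sub yz by auto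
    ultimately have "Ck_on k F B"
      by (rule Ck_on_transform[OF B])
    with fB B \<open>x0 \<in> B\<close> show ?thesis by blast
  qed
  then show "Ck_on k f I" "Ck_on k F I"
    by (meson Ck_on_local)+
qed

section \<open>Regularity passes back to \<phi> with a gain of one derivative\<close>

text \<open>At these points \<open>u\<close> the equation determines \<open>\<phi> u\<close> as a
  quotient of increments of \<open>F\<close> and \<open>f\<close>.\<close>

definition asym_centres :: "real set" where
  "asym_centres = {u \<in> I. \<exists>v. u + v \<in> I \<and> u - v \<in> I \<and> f (u + v) \<noteq> f (u - v)}"

text \<open>The start of the bootstrap: \<open>Ck_on_f_F\<close> with \<open>W = I\<close> and
  \<open>k = 0\<close>.\<close>

lemma continuous_on_f_F: "continuous_on I f" "continuous_on I F"
proof -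
  have "{a<..<b} \<inter> I \<noteq> {}" if "a < b" "{a<..<b} \<subseteq> I" for a b
  proof -
    have "(a + b) / 2 \<in> {a<..<b}" using that(1) by simp
    then show ?thesis using that(2) by blast
  qed
  from Ck_on_f_F[OF I_open subset_refl this, of 0] cont
  show "continuous_on I f" "continuous_on I F" by auto
qed

lemma open_asym_centres: "open asym_centres"
proof -
  have "open ((I \<inter> (\<lambda>u. u + v) -` I \<inter> (\<lambda>u. u - v) -` I)
          \<inter> (\<lambda>u. f (u + v) - f (u - v)) -` (- {0}))" for v
    by (intro continuous_open_preimage open_Int open_vimage I_open continuous_intros
          continuous_on_compose2[OF continuous_on_f_F(1)]) auto
  then have "open (\<Union>v. (I \<inter> (\<lambda>u. u + v) -` I \<inter> (\<lambda>u. u - v) -` I)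
          \<inter> (\<lambda>u. f (u + v) - f (u - v)) -` (- {0}))" by blast
  also have "(\<Union>v. (I \<inter> (\<lambda>u. u + v) -` I \<inter> (\<lambda>u. u - v) -` I)
          \<inter> (\<lambda>u. f (u + v) - f (u - v)) -` (- {0})) = asym_centres"
    by (auto simp: asym_centres_def)
  finally show ?thesis .
qed

text \<open>If every point of \<open>{a<..<b}\<close> were a centre of symmetry, each
  \<open>x\<close> there could be reflected onto the midpoint \<open>c\<close> about
  \<open>(x + c) / 2\<close>. Then \<open>f\<close> would be constant on \<open>{a<..<b}\<close>,
  hence on \<open>I\<close>.\<close>

lemma asym_centres_dense:
  assumes "x0 \<in> I" "x1 \<in> I" "f x0 \<noteq> f x1" "a < b" "{a<..<b} \<subseteq> I"
  shows "{a<..<b} \<inter> asym_centres \<noteq> {}"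
proof
  assume sym: "{a<..<b} \<inter> asym_centres = {}"
  define c where "c = (a + b) / 2"
  have "f x = f c" if x: "x \<in> {a<..<b}" for x
  proof -
    have c: "c \<in> {a<..<b}" using assms(4) by (auto simp: c_def)
    define u v where "u = (x + c) / 2" and "v = (x - c) / 2"
    have "u \<in> {a<..<b}" using x c by (auto simp: u_def)
    then have "u \<in> I" "u \<notin> asym_centres" using sym assms(5) by auto
    moreover have "u + v = x" "u - v = c" by (auto simp: u_def v_def field_simps)
    ultimately show ?thesis
      using x c assms(5) by (auto simp: asym_centres_def subset_iff)
  qed
  from f_const_extend[OF assms(4,5) this] assms(1-3) show False by metis
qed

lemma Ck_on_phi_Suc:
  assumes "Ck_on k f I" "Ck_on k F I"
  shows "Ck_on (Suc k) \<phi> asym_centres"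
proof (rule Ck_on_local)
  fix u0 assume u0: "u0 \<in> asym_centres"
  obtain G where G: "\<And>x. x \<in> I \<Longrightarrow> (G has_real_derivative f x) (at x)"
    using open_interval_antiderivative[OF I_open I_interval continuous_on_f_F(1)] by metis
  obtain H where H: "\<And>x. x \<in> I \<Longrightarrow> (H has_real_derivative F x) (at x)"
    using open_interval_antiderivative[OF I_open I_interval continuous_on_f_F(2)] by metis
  have CG: "Ck_on (Suc k) G I" and CH: "Ck_on (Suc k) H I"
    using Ck_on_SucI[OF I_open G assms(1)] Ck_on_SucI[OF I_open H assms(2)] by auto
  \<comment> \<open>The shifts \<open>w\<close> for which \<open>u + w\<close> and
    \<open>u - w\<close> both lie in \<open>I\<close>.\<close>
  define N where "N = (\<lambda>u. (\<lambda>w. u + w) -` I \<inter> (\<lambda>w. u - w) -` I)"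
  \<comment> \<open>The plus sign is right: differentiating \<open>G (u - w)\<close> in
    \<open>w\<close> gives \<open>- f (u - w)\<close>. So \<open>K u\<close> and \<open>L u\<close>
    are antiderivatives of the two differences in the equation.\<close>
  define K where "K = (\<lambda>u w. G (u + w) + G (u - w))"
  define L where "L = (\<lambda>u w. H (u + w) + H (u - w))"
  have openN: "open (N u)" for u
    unfolding N_def by (intro open_Int open_vimage I_open continuous_intros)
  have convN: "is_interval (N u)" for u
    unfolding is_interval_1
  proof safe
    fix a b x assume "a \<in> N u" "b \<in> N u" "a \<le> x" "x \<le> b"
    then show "x \<in> N u"
      unfolding N_def using mem_between[of "u + a" "u + b" "u + x"] mem_between[of "u - b" "u - a" "u - x"]
      by auto
  qed
  have dK: "(K u has_real_derivative f (u + w) - f (u - w)) (at w)" if "w \<in> N u" for u w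
    unfolding K_def using that
    by (auto intro!: derivative_eq_intros DERIV_chain2[OF G] simp: N_def)
  have dL: "(L u has_real_derivative F (u + w) - F (u - w)) (at w)" if "w \<in> N u" for u w
    unfolding L_def using that
    by (auto intro!: derivative_eq_intros DERIV_chain2[OF H] simp: N_def)
  \<comment> \<open>The derivative in \<open>w\<close> vanishes by the functional equation at \<open>u + w\<close>, \<open>u - w\<close>.\<close>
  have const: "\<phi> u * K u w - L u w = \<phi> u * K u w' - L u w'" if w: "w \<in> N u" "w' \<in> N u" for u w w'
  proof -
    have "((\<lambda>w. \<phi> u * K u w - L u w) has_real_derivative 0) (at t)" if t: "t \<in> N u" for t
      using dK[OF t] dL[OF t] eq[of "u + t" "u - t"] t
      by (auto intro!: derivative_eq_intros simp: N_def mult.commute)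
    then obtain C where "\<forall>t\<in>N u. \<phi> u * K u t - L u t = C"
      using has_field_derivative_zero_constant[of "N u" "\<lambda>w. \<phi> u * K u w - L u w"] convN[of u]
      by (metis is_interval_convex has_field_derivative_at_within)
    then show ?thesis using w by metis
  qed
  obtain v where v: "v \<in> N u0" "f (u0 + v) \<noteq> f (u0 - v)"
    using u0 by (auto simp: asym_centres_def N_def)
  \<comment> \<open>If \<open>K u0\<close> were constant on \<open>N u0\<close>, its derivative at
    \<open>v\<close> would vanish, against the choice of \<open>v\<close>.\<close>
  obtain w where w: "w \<in> N u0" "K u0 w \<noteq> K u0 v"
  proof (rule ccontr)
    assume "\<not> thesis"
    then have "\<And>w. w \<in> N u0 \<Longrightarrow> K u0 v = K u0 w" using that by metis
    then have "(K u0 has_real_derivative 0) (at v)"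
      by (intro has_field_derivative_transform_within_open[OF DERIV_const openN v(1)])
    from DERIV_unique[OF this dK[OF v(1)]] v(2) show False by simp
  qed
  \<comment> \<open>The shifts \<open>v\<close> and \<open>w\<close> found at \<open>u0\<close> are
    kept fixed for nearby \<open>u\<close>, so \<open>K\<close> and \<open>L\<close> depend on
    \<open>u\<close> only through translates of \<open>G\<close> and \<open>H\<close>.\<close>
  define B0 where "B0 = asym_centres \<inter> {u. v \<in> N u} \<inter> {u. w \<in> N u}"
  have B0: "open B0"
  proof -
    have "open {u. t \<in> N u}" for t
    proof -
      have "{u. t \<in> N u} = (\<lambda>u. u + t) -` I \<inter> (\<lambda>u. u - t) -` I"
        by (auto simp: N_def)
      also have "open \<dots>"
        by (intro open_Int open_vimage I_open continuous_intros)
      finally show ?thesis .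
    qed
    then show ?thesis unfolding B0_def using open_asym_centres by blast
  qed
  have CK: "Ck_on (Suc k) (\<lambda>u. K u t) B0" and CL: "Ck_on (Suc k) (\<lambda>u. L u t) B0"
    if "t = v \<or> t = w" for t
    using that Ck_on_translate[OF B0, of t I, OF _ CG] Ck_on_translate[OF B0, of "- t" I, OF _ CG]
      Ck_on_translate[OF B0, of t I, OF _ CH] Ck_on_translate[OF B0, of "- t" I, OF _ CH]
    unfolding K_def L_def
    by (intro Ck_on_add B0; auto simp: B0_def N_def simp del: Ck_on.simps)+
  define B where "B = B0 \<inter> (\<lambda>u. K u w - K u v) -` (- {0})"
  have CD: "Ck_on (Suc k) (\<lambda>u. K u w - K u v) B0" "Ck_on (Suc k) (\<lambda>u. L u w - L u v) B0"
    using CK CL by (intro Ck_on_diff B0; blast)+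
  have B: "open B"
    unfolding B_def
    by (intro continuous_open_preimage B0 Ck_on_imp_continuous_on[OF CD(1)]) auto
  have BB0: "B \<subseteq> B0" by (auto simp: B_def)
  have "u0 \<in> B" using u0 v w by (auto simp: B_def B0_def)
  have "Ck_on (Suc k) (\<lambda>u. (L u w - L u v) / (K u w - K u v)) B"
    by (intro Ck_on_divide B Ck_on_subset[OF CD(1) BB0] Ck_on_subset[OF CD(2) BB0])
       (auto simp: B_def)
  \<comment> \<open>This is \<open>const\<close> for the shifts \<open>w\<close> and
    \<open>v\<close>, solved for \<open>\<phi> u\<close>.\<close>
  moreover have "\<phi> u = (L u w - L u v) / (K u w - K u v)" if "u \<in> B" for u
    using const[of w u v] that by (auto simp: B_def B0_def field_simps)
  ultimately have "Ck_on (Suc k) \<phi> B"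
    by (rule Ck_on_transform[OF B])
  with B \<open>u0 \<in> B\<close> show "\<exists>B. open B \<and> u0 \<in> B \<and> Ck_on (Suc k) \<phi> B" by blast
qed

section \<open>The bootstrap and the limit identity\<close>

lemma Ck_on_f: "Ck_on k f I"
proof (cases "\<exists>x0\<in>I. \<exists>x1\<in>I. f x0 \<noteq> f x1")
  case True
  then obtain x0 x1 where x: "x0 \<in> I" "x1 \<in> I" "f x0 \<noteq> f x1" by blast
  have "Ck_on k f I \<and> Ck_on k F I"
  proof (induction k)
    case 0
    then show ?case by (simp add: continuous_on_f_F)
  next
    \<comment> \<open>\<phi> gains an order on the dense open set \<open>asym_centres\<close>, and
      \<open>Ck_on_f_F\<close> carries that order to \<open>f\<close> and \<open>F\<close> on all of
      \<open>I\<close>.\<close>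
    case (Suc k)
    have "asym_centres \<subseteq> I" by (auto simp: asym_centres_def)
    then show ?case
      using Suc Ck_on_f_F[OF open_asym_centres _ asym_centres_dense[OF x], of "Suc k"] Ck_on_phi_Suc[of k] by simp
  qed
  then show ?thesis by blast
\<comment> \<open>For constant \<open>f\<close> the set \<open>asym_centres\<close> is empty, so
  this case is settled directly.\<close>
next
  case False
  then obtain c where "\<And>x. x \<in> I \<Longrightarrow> f x = c" by metis
  then show ?thesis
    by (rule Ck_on_transform[OF I_open Ck_on_const[OF I_open]])
qed

lemma deriv_identity:
  assumes "x \<in> I" "y \<in> I"
  shows "\<phi> ((x + y) / 2) * (deriv f x + deriv f y) = \<phi> x * deriv f x + \<phi> y * deriv f y"
proof -
  have lim: "((\<lambda>h. sym_diff_op h f x / (2 * h)) \<longlongrightarrow> deriv f x) (at_right 0)" if "x \<in> I" for x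
  proof -
    have d: "(f has_real_derivative deriv f x) (at x)"
      using Ck_on_has_deriv[OF Ck_on_f that] .
    \<comment> \<open>As a function of \<open>h\<close> the symmetric difference vanishes at 0, so
      its difference quotient there is the expression divided by \<open>h\<close>.\<close>
    have "((\<lambda>h. f (x + h) - f (x - h)) has_real_derivative 2 * deriv f x) (at 0)"
      using d by (auto intro!: derivative_eq_intros DERIV_chain2[where f = f])
    then have "((\<lambda>h. (f (x + h) - f (x - h)) / h) \<longlongrightarrow> 2 * deriv f x) (at_right 0)"
      by (auto simp: has_field_derivative_iff intro: filterlim_at_split[THEN iffD1, THEN conjunct2])
    from tendsto_divide[OF this tendsto_const[of 2]] show ?thesis
      by (simp add: sym_diff_op_def mult.commute)
  qed
  \<comment> \<open>Since \<open>I\<close> is open, part one applies at any given point of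
    \<open>I\<close> once \<open>h\<close> is small.\<close>
  have shrink: "\<forall>\<^sub>F h in at_right 0. x \<in> shrink h I" if x: "x \<in> I" for x
  proof -
    obtain e where e: "e > 0" "ball x e \<subseteq> I"
      using x I_open open_contains_ball by blast
    have "x \<in> shrink h I" if "0 < h" "h < e" for h
    proof -
      have "x + h \<in> I" "x - h \<in> I"
        using that e(2) by (auto simp: subset_iff dist_real_def)
      then show ?thesis
        unfolding shrink_def by (auto intro: rev_image_eqI)
    qed
    then show ?thesis
      using e(1) by (auto simp: eventually_at_right_field)
  qed
  let ?q = "\<lambda>x h. sym_diff_op h f x / (2 * h)"
  have lhs: "((\<lambda>h. \<phi> ((x + y) / 2) * (?q x h + ?q y h)) \<longlongrightarrow>
      \<phi> ((x + y) / 2) * (deriv f x + deriv f y)) (at_right 0)"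
    by (intro tendsto_intros lim assms)
  have "\<forall>\<^sub>F h in at_right 0.
      \<phi> ((x + y) / 2) * (?q x h + ?q y h) = \<phi> x * ?q x h + \<phi> y * ?q y h"
    using shrink[OF assms(1)] shrink[OF assms(2)]
  proof eventually_elim
    case (elim h)
    have "\<forall>x\<in>I. \<forall>y\<in>I. \<phi> ((x + y) / 2) * (f x - f y) = F x - F y" using eq by blast
    from sym_diff_identity[OF this elim] show ?case
      by (simp flip: add_divide_distrib)
  qed
  then have rhs: "((\<lambda>h. \<phi> ((x + y) / 2) * (?q x h + ?q y h)) \<longlongrightarrow>
      \<phi> x * deriv f x + \<phi> y * deriv f y) (at_right 0)"
    by (subst tendsto_cong) (assumption, intro tendsto_intros lim assms)
  show ?thesis
    by (rule tendsto_unique[OF trivial_limit_at_right_real lhs rhs])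
qed

end

theorem theorem3:
  fixes I :: "real set" and \<phi> f F :: "real \<Rightarrow> real"
  assumes "I \<noteq> {}" and "open I" and "is_interval I"
    and "\<forall>x\<in>I. \<forall>y\<in>I. \<phi> ((x + y) / 2) * (f x - f y) = F x - F y"
  shows "(\<forall>h>0. \<forall>x\<in>shrink h I. \<forall>y\<in>shrink h I.
            \<phi> ((x + y) / 2) * (sym_diff_op h f x + sym_diff_op h f y)
              = \<phi> x * sym_diff_op h f x + \<phi> y * sym_diff_op h f y)
       \<and> (continuous_on I \<phi> \<and> locally_nonconstant_on \<phi> I \<longrightarrow>
            infinitely_differentiable_on f I
          \<and> (\<forall>x\<in>I. \<forall>y\<in>I. \<phi> ((x + y) / 2) * (deriv f x + deriv f y)
                = \<phi> x * deriv f x + \<phi> y * deriv f y))"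
proof (intro conjI impI)
  show "\<forall>h>0. \<forall>x\<in>shrink h I. \<forall>y\<in>shrink h I.
          \<phi> ((x + y) / 2) * (sym_diff_op h f x + sym_diff_op h f y)
            = \<phi> x * sym_diff_op h f x + \<phi> y * sym_diff_op h f y"
    by (intro allI ballI impI sym_diff_identity[OF assms(4)])
  assume "continuous_on I \<phi> \<and> locally_nonconstant_on \<phi> I"
  then interpret midpoint_equation I \<phi> f F
    using assms by unfold_locales auto
  show "infinitely_differentiable_on f I"
    unfolding infinitely_differentiable_on_def
    by (intro allI ballI Ck_on_imp_deriv_funpow[OF Ck_on_f])
  show "\<forall>x\<in>I. \<forall>y\<in>I. \<phi> ((x + y) / 2) * (deriv f x + deriv f y)
      = \<phi> x * deriv f x + \<phi> y * deriv f y"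
    by (intro ballI deriv_identity)
qed

end
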